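(* Let $v$ be a positive integer and, for $1\le i\le v$, let $f_i:(X_i,\kappa_i)\to(Y_i,\lambda_i)$ be a continuous surjection between (nonempty) digital images. Then the product map $$f=\prod_{i=1}^v f_i: \Big(\prod_{i=1}^v X_i, NP_v(\kappa_1,\ldots,\kappa_v)\Big)\to\Big(\prod_{i=1}^v Y_i, NP_v(\lambda_1,\ldots,\lambda_v)\Big),\quad f(x_1,\dots,x_v)=(f_1(x_1),\dots,f_v(x_v)),$$ is shy if and only if each $f_i$ is a shy map.
   Context: A digital image $(X,\kappa)$ is a set $X$ (of lattice points in some $\mathbb{Z}^n$) with an adjacency relation $\kappa$, i.e. a symmetric irreflexive binary relation on $X$. A subset $A$ of $X$ is $\kappa$-connected if any two points of $A$ are joined by a finite sequence in $A$ whose consecutive terms are $\kappa$-adjacent. A function $f:(X,\kappa)\to(Y,\lambda)$ is continuous if for all $\kappa$-adjacent $x,x'\in X$ the points $f(x),f(x')$ are equal or $\lambda$-adjacent. A continuous surjection $f:X\to Y$ of digital images is shy if $f^{-1}(y)$ is connected for each $y\in Y$, and $f^{-1}(\{y_0,y_1\})$ is connected whenever $y_0,y_1\in Y$ are adjacent. $NP_v(\kappa_1,\dots,\kappa_v)$-adjacency on $\prod_{i=1}^v X_i$: two distinct points $(x_1,\dots,x_v)$ and $(x_1',\dots,x_v')$ are adjacent iff for every $i$, $x_i$ and $x_i'$ are equal or $\kappa_i$-adjacent. *)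

theory Defs
  imports "HOL-Library.FuncSet"
begin

text \<open>The points of \<open>\<int>\<^sup>n\<close> are the integer lists of length \<open>n\<close>, so that digital images of
  different dimensions share one type.\<close>

definition lattice_points :: "nat \<Rightarrow> int list set" where
  "lattice_points n = {p. length p = n}"

definition digital_image :: "int list set \<Rightarrow> (int list \<times> int list) set \<Rightarrow> bool" where
  "digital_image X \<kappa> \<longleftrightarrow>
     (\<exists>n. X \<subseteq> lattice_points n) \<and> \<kappa> \<subseteq> X \<times> X \<and> sym \<kappa> \<and> irrefl \<kappa>"

text \<open>The notions below use only a set with an adjacency relation on it. They are polymorphic
  so as to apply also to products, whose points are tuples of lattice points.\<close>

definition digitally_connected :: "('a \<times> 'a) set \<Rightarrow> 'a set \<Rightarrow> bool" where
  "digitally_connected \<kappa> A \<longleftrightarrow>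
     (\<forall>x\<in>A. \<forall>y\<in>A. \<exists>ps. ps \<noteq> [] \<and> hd ps = x \<and> last ps = y \<and> set ps \<subseteq> A \<and>
        successively (\<lambda>p q. (p, q) \<in> \<kappa>) ps)"

definition digitally_continuous ::
  "'a set \<Rightarrow> ('a \<times> 'a) set \<Rightarrow> 'b set \<Rightarrow> ('b \<times> 'b) set \<Rightarrow> ('a \<Rightarrow> 'b) \<Rightarrow> bool" where
  "digitally_continuous X \<kappa> Y \<mu> f \<longleftrightarrow>
     f \<in> X \<rightarrow> Y \<and>
     (\<forall>x\<in>X. \<forall>x'\<in>X. (x, x') \<in> \<kappa> \<longrightarrow> f x = f x' \<or> (f x, f x') \<in> \<mu>)"

definition shy ::
  "'a set \<Rightarrow> ('a \<times> 'a) set \<Rightarrow> 'b set \<Rightarrow> ('b \<times> 'b) set \<Rightarrow> ('a \<Rightarrow> 'b) \<Rightarrow> bool" where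
  "shy X \<kappa> Y \<mu> f \<longleftrightarrow>
     digitally_continuous X \<kappa> Y \<mu> f \<and> f ` X = Y \<and>
     (\<forall>y\<in>Y. digitally_connected \<kappa> (f -` {y} \<inter> X)) \<and>
     (\<forall>y\<^sub>0\<in>Y. \<forall>y\<^sub>1\<in>Y. (y\<^sub>0, y\<^sub>1) \<in> \<mu> \<longrightarrow> digitally_connected \<kappa> (f -` {y\<^sub>0, y\<^sub>1} \<inter> X))"

text \<open>Tuples \<open>(x\<^sub>1, \<dots>, x\<^sub>v)\<close> are extensional functions on \<open>{1..v}\<close>, that is, functions
  that are \<open>undefined\<close> at all other indices.\<close>

definition NP_adj ::
  "nat \<Rightarrow> (nat \<Rightarrow> 'a set) \<Rightarrow> (nat \<Rightarrow> ('a \<times> 'a) set) \<Rightarrow> ((nat \<Rightarrow> 'a) \<times> (nat \<Rightarrow> 'a)) set" where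
  "NP_adj v X \<kappa> =
     {(x, x'). x \<in> PiE {1..v} X \<and> x' \<in> PiE {1..v} X \<and> x \<noteq> x' \<and>
        (\<forall>i\<in>{1..v}. x i = x' i \<or> (x i, x' i) \<in> \<kappa> i)}"

definition product_map :: "nat \<Rightarrow> (nat \<Rightarrow> 'a \<Rightarrow> 'b) \<Rightarrow> (nat \<Rightarrow> 'a) \<Rightarrow> nat \<Rightarrow> 'b" where
  "product_map v f x = (\<lambda>i\<in>{1..v}. f i (x i))"

end

theory Submission imports Defs begin

text \<open>A product of connected sets is connected because one coordinate can be moved at a time, and
  conversely the coordinate projections carry connectedness from fibres of the product map to fibres
  of the factors. The fibre over an adjacent pair \<open>y, y'\<close> of tuples is not a product but the union of
  the fibres over \<open>y\<close> and \<open>y'\<close>; these two connected sets are linked by choosing, in each coordinate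
  where \<open>y\<close> and \<open>y'\<close> differ, adjacent points over \<open>y i\<close> and \<open>y' i\<close>, and equal points in the others.\<close>

section \<open>Connectedness as reachability by adjacency steps\<close>

lemma successively_imp_rtrancl:
  assumes "ps \<noteq> []" "set ps \<subseteq> A" "successively (\<lambda>p q. (p, q) \<in> r) ps"
  shows "(hd ps, last ps) \<in> (r \<inter> A \<times> A)\<^sup>*"
  using assms
proof (induction ps rule: induct_list012)
  case (3 x y zs)
  then have "(y, last (y # zs)) \<in> (r \<inter> A \<times> A)\<^sup>*" by simp
  moreover have "(x, y) \<in> r \<inter> A \<times> A" using 3 by simp
  ultimately show ?case by (auto intro: converse_rtrancl_into_rtrancl)
qed auto

text \<open>The hypothesis \<open>x \<in> A\<close> covers the path with one point: the closure
  relates every point to itself, even outside \<open>A\<close>.\<close>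

lemma rtrancl_imp_successively:
  assumes "(x, y) \<in> (r \<inter> A \<times> A)\<^sup>*" "x \<in> A"
  shows "\<exists>ps. ps \<noteq> [] \<and> hd ps = x \<and> last ps = y \<and> set ps \<subseteq> A \<and>
    successively (\<lambda>p q. (p, q) \<in> r) ps"
  using assms(1)
proof (induction rule: rtrancl_induct)
  case base
  show ?case by (rule exI[of _ "[x]"]) (use assms(2) in simp)
next
  case (step y z)
  then obtain ps where "ps \<noteq> []" "hd ps = x" "last ps = y" "set ps \<subseteq> A"
    "successively (\<lambda>p q. (p, q) \<in> r) ps" by blast
  with step show ?case
    by (intro exI[of _ "ps @ [z]"]) (auto simp: successively_append_iff)
qed

text \<open>Trades lists of points for a closure, so that later arguments can use rule induction,
  monotonicity and transitivity.\<close>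

lemma digitally_connected_iff_rtrancl:
  "digitally_connected \<kappa> A \<longleftrightarrow> (\<forall>x\<in>A. \<forall>y\<in>A. (x, y) \<in> (\<kappa> \<inter> A \<times> A)\<^sup>*)"
proof
  assume "digitally_connected \<kappa> A"
  then show "\<forall>x\<in>A. \<forall>y\<in>A. (x, y) \<in> (\<kappa> \<inter> A \<times> A)\<^sup>*"
    unfolding digitally_connected_def by (metis successively_imp_rtrancl)
next
  assume "\<forall>x\<in>A. \<forall>y\<in>A. (x, y) \<in> (\<kappa> \<inter> A \<times> A)\<^sup>*"
  then show "digitally_connected \<kappa> A"
    unfolding digitally_connected_def using rtrancl_imp_successively by metis
qed

lemma rtrancl_map_reflcl:
  assumes "(x, y) \<in> r\<^sup>*" "\<And>a b. (a, b) \<in> r \<Longrightarrow> (g a, g b) \<in> s\<^sup>="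
  shows "(g x, g y) \<in> s\<^sup>*"
  using assms(1)
proof (induction rule: rtrancl_induct)
  case (step y z)
  have "g y = g z \<or> (g y, g z) \<in> s" using assms(2)[OF step.hyps(2)] by auto
  with step.IH show ?case by (auto intro: rtrancl_into_rtrancl)
qed simp

text \<open>Such a \<open>g\<close> sends a path to a path that may pause where adjacent points are
  identified. Stated for any target adjacency, it applies to coordinate projections.\<close>

lemma digitally_connected_image:
  assumes "digitally_connected \<kappa> A"
    and "\<And>x x'. x \<in> A \<Longrightarrow> x' \<in> A \<Longrightarrow> (x, x') \<in> \<kappa> \<Longrightarrow> g x = g x' \<or> (g x, g x') \<in> \<mu>"
  shows "digitally_connected \<mu> (g ` A)"
proof -
  have "(g x, g y) \<in> (\<mu> \<inter> g ` A \<times> g ` A)\<^sup>*" if "x \<in> A" "y \<in> A" for x y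
  proof -
    have "(x, y) \<in> (\<kappa> \<inter> A \<times> A)\<^sup>*"
      using assms(1) that by (simp add: digitally_connected_iff_rtrancl)
    then show ?thesis
      by (rule rtrancl_map_reflcl) (use assms(2) in auto)
  qed
  then show ?thesis by (auto simp: digitally_connected_iff_rtrancl)
qed

text \<open>Any path between the two sets can be routed through the link from \<open>a\<close> to
  \<open>b\<close>; symmetry of \<open>\<kappa>\<close> makes the link usable in both
  directions.\<close>

lemma digitally_connected_Un:
  assumes A: "digitally_connected \<kappa> A" and B: "digitally_connected \<kappa> B"
    and a: "a \<in> A" and b: "b \<in> B" and ab: "a = b \<or> (a, b) \<in> \<kappa>" and "sym \<kappa>"
  shows "digitally_connected \<kappa> (A \<union> B)"
proof -
  let ?R = "(\<kappa> \<inter> (A \<union> B) \<times> (A \<union> B))\<^sup>*"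
  have ba: "b = a \<or> (b, a) \<in> \<kappa>" using ab \<open>sym \<kappa>\<close> by (auto dest: symD)
  have "(\<kappa> \<inter> A \<times> A)\<^sup>* \<subseteq> ?R" "(\<kappa> \<inter> B \<times> B)\<^sup>* \<subseteq> ?R"
    by (intro rtrancl_mono; blast)+
  with A B have within: "(x, y) \<in> ?R" if "x \<in> A \<and> y \<in> A \<or> x \<in> B \<and> y \<in> B" for x y
    using that by (auto simp: digitally_connected_iff_rtrancl)
  have "(a, b) \<in> ?R" "(b, a) \<in> ?R" using ab ba a b by blast+
  then have "(x, y) \<in> ?R" if "x \<in> A \<union> B" "y \<in> A \<union> B" for x y
    using that within[of x y] within[of x a] within[of x b] within[of a y] within[of b y] a b
    by (elim UnE) (auto intro: rtrancl_trans)
  then show ?thesis by (simp add: digitally_connected_iff_rtrancl)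
qed

text \<open>A path that starts in \<open>U\<close> and ends outside must leave \<open>U\<close> at
  some step. This extracts adjacent points over two adjacent values from the connectedness of their
  joint fibre.\<close>

lemma digitally_connected_crossing:
  assumes "digitally_connected \<kappa> A" "x \<in> A" "y \<in> A" "x \<in> U" "y \<notin> U"
  obtains a b where "a \<in> A" "b \<in> A" "a \<in> U" "b \<notin> U" "(a, b) \<in> \<kappa>"
proof -
  have "(x, y) \<in> (\<kappa> \<inter> A \<times> A)\<^sup>*"
    using assms by (simp add: digitally_connected_iff_rtrancl)
  \<comment> \<open>In the inductive step, either the previous point is already outside
    \<open>U\<close> and the induction hypothesis applies, or the last step is the crossing.\<close>
  then have "y \<notin> U \<longrightarrow> (\<exists>a b. a \<in> A \<and> b \<in> A \<and> a \<in> U \<and> b \<notin> U \<and> (a, b) \<in> \<kappa>)"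
    by (induction rule: rtrancl_induct) (use assms(4) in auto)
  with assms(5) that show thesis by blast
qed

section \<open>Product adjacency and connected products\<close>

lemma sym_NP_adj:
  assumes "\<And>i. i \<in> {1..v} \<Longrightarrow> sym (\<kappa> i)"
  shows "sym (NP_adj v X \<kappa>)"
proof (rule symI)
  fix x x' assume adj: "(x, x') \<in> NP_adj v X \<kappa>"
  have "x' i = x i \<or> (x' i, x i) \<in> \<kappa> i" if i: "i \<in> {1..v}" for i
  proof -
    have "x i = x' i \<or> (x i, x' i) \<in> \<kappa> i" using adj i unfolding NP_adj_def by blast
    then show ?thesis using symD[OF assms[OF i]] by metis
  qed
  with adj show "(x', x) \<in> NP_adj v X \<kappa>" by (auto simp: NP_adj_def)
qed

lemma digitally_connected_PiE:
  assumes conn: "\<And>i. i \<in> {1..v} \<Longrightarrow> digitally_connected (\<kappa> i) (A i)"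
    and sub: "\<And>i. i \<in> {1..v} \<Longrightarrow> A i \<subseteq> X i"
  shows "digitally_connected (NP_adj v X \<kappa>) (PiE {1..v} A)"
proof -
  let ?P = "PiE {1..v} A"
  let ?R = "NP_adj v X \<kappa> \<inter> ?P \<times> ?P"
  have PX: "?P \<subseteq> PiE {1..v} X" using sub by (intro PiE_mono) auto
  \<comment> \<open>A path in \<open>A j\<close> is lifted by \<open>\<lambda>u. x(j := u)\<close>:
    tuples that differ only in coordinate \<open>j\<close> are NP-adjacent once their entries there
    are distinct and adjacent.\<close>
  have move: "(x(j := s), x(j := t)) \<in> ?R\<^sup>*"
    if x: "x \<in> ?P" and j: "j \<in> {1..v}" and st: "s \<in> A j" "t \<in> A j" for x j s t
  proof -
    have upd: "x(j := u) \<in> ?P" if "u \<in> A j" for u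
      using x j that by (auto simp: PiE_iff extensional_def)
    have "(s, t) \<in> (\<kappa> j \<inter> A j \<times> A j)\<^sup>*"
      using conn j st by (simp add: digitally_connected_iff_rtrancl)
    moreover have "(x(j := u), x(j := w)) \<in> ?R\<^sup>=" if "(u, w) \<in> \<kappa> j \<inter> A j \<times> A j" for u w
    proof -
      have "x(j := u) \<in> ?P" "x(j := w) \<in> ?P" using that upd by blast+
      with that PX show ?thesis unfolding NP_adj_def by auto
    qed
    ultimately show ?thesis by (rule rtrancl_map_reflcl)
  qed
  \<comment> \<open>Induction on a finite set \<open>J\<close> containing all coordinates where
    \<open>x\<close> and \<open>y\<close> differ; each step corrects one of them.\<close>
  have "(x, y) \<in> ?R\<^sup>*"
    if "finite J" "J \<subseteq> {1..v}" "x \<in> ?P" "y \<in> ?P" "\<forall>i. i \<notin> J \<longrightarrow> x i = y i" for J x y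
    using that
  proof (induction J arbitrary: x rule: finite_induct)
    case empty
    then have "x = y" by auto
    then show ?case by simp
  next
    case (insert j J)
    have j: "j \<in> {1..v}" "x j \<in> A j" "y j \<in> A j" using insert.prems by auto
    have "x(j := y j) \<in> ?P"
      using insert.prems(2) j by (auto simp: PiE_iff extensional_def)
    moreover have "\<forall>i. i \<notin> J \<longrightarrow> (x(j := y j)) i = y i" using insert.prems by auto
    ultimately have "(x(j := y j), y) \<in> ?R\<^sup>*"
      using insert.IH insert.prems by blast
    moreover have "(x(j := x j), x(j := y j)) \<in> ?R\<^sup>*"
      using move[OF insert.prems(2) j(1) j(2) j(3)] .
    ultimately show ?case by (metis fun_upd_triv rtrancl_trans)
  qed
  \<comment> \<open>Off the index set both tuples take the value \<open>undefined\<close>, so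
    \<open>J = {1..v}\<close> is admissible.\<close>
  moreover have "\<forall>i. i \<notin> {1..v} \<longrightarrow> x i = y i" if "x \<in> ?P" "y \<in> ?P" for x y
    using that by (metis PiE_arb)
  ultimately show ?thesis
    unfolding digitally_connected_iff_rtrancl
    by (intro ballI) (metis finite_atLeastAtMost order_refl)
qed

section \<open>Fibres, continuity and surjectivity of the product map\<close>

lemma product_map_apply: "i \<in> {1..v} \<Longrightarrow> product_map v f x i = f i (x i)"
  by (simp add: product_map_def)

lemma product_map_eq_iff:
  assumes "y \<in> PiE {1..v} Y"
  shows "product_map v f x = y \<longleftrightarrow> (\<forall>i\<in>{1..v}. f i (x i) = y i)"
proof
  assume "\<forall>i\<in>{1..v}. f i (x i) = y i"
  then show "product_map v f x = y"
    unfolding product_map_def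
    by (intro extensionalityI[where A = "{1..v}"]) (use assms in \<open>auto simp: PiE_iff\<close>)
qed (auto simp: product_map_def)

lemma product_map_vimage:
  assumes "y \<in> PiE {1..v} Y"
  shows "product_map v f -` {y} \<inter> PiE {1..v} X = PiE {1..v} (\<lambda>i. f i -` {y i} \<inter> X i)"
  using product_map_eq_iff[OF assms] by (auto simp: PiE_iff)

lemma digitally_continuous_product_map:
  assumes "\<And>i. i \<in> {1..v} \<Longrightarrow> digitally_continuous (X i) (\<kappa> i) (Y i) (\<mu> i) (f i)"
  shows "digitally_continuous (PiE {1..v} X) (NP_adj v X \<kappa>) (PiE {1..v} Y) (NP_adj v Y \<mu>)
    (product_map v f)"
proof -
  have maps: "f i \<in> X i \<rightarrow> Y i" if "i \<in> {1..v}" for i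
    using assms[OF that] by (simp add: digitally_continuous_def)
  then have into: "product_map v f x \<in> PiE {1..v} Y" if "x \<in> PiE {1..v} X" for x
    using that unfolding product_map_def by (intro restrict_PiE_iff[THEN iffD2]) fastforce
  have "f i (x i) = f i (x' i) \<or> (f i (x i), f i (x' i)) \<in> \<mu> i"
    if "(x, x') \<in> NP_adj v X \<kappa>" "i \<in> {1..v}" for x x' i
  proof -
    have "x i \<in> X i" "x' i \<in> X i" "x i = x' i \<or> (x i, x' i) \<in> \<kappa> i"
      using that by (auto simp: NP_adj_def)
    then show ?thesis using assms[OF that(2)] unfolding digitally_continuous_def by metis
  qed
  then have "product_map v f x = product_map v f x' \<or>
      (product_map v f x, product_map v f x') \<in> NP_adj v Y \<mu>"
    if "(x, x') \<in> NP_adj v X \<kappa>" for x x'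
    using that into by (auto simp: NP_adj_def product_map_apply)
  with into show ?thesis by (auto simp: digitally_continuous_def)
qed

lemma product_map_image:
  assumes "\<And>i. i \<in> {1..v} \<Longrightarrow> f i ` X i = Y i"
  shows "product_map v f ` PiE {1..v} X = PiE {1..v} Y"
proof
  show "product_map v f ` PiE {1..v} X \<subseteq> PiE {1..v} Y"
    using assms by (fastforce simp: product_map_def)
next
  show "PiE {1..v} Y \<subseteq> product_map v f ` PiE {1..v} X"
  proof
    fix y assume y: "y \<in> PiE {1..v} Y"
    then have "\<forall>i\<in>{1..v}. \<exists>s. s \<in> X i \<and> f i s = y i"
      using assms by (metis PiE_mem imageE)
    then obtain x where x: "\<forall>i\<in>{1..v}. x i \<in> X i \<and> f i (x i) = y i" by metis
    then have "product_map v f (restrict x {1..v}) = y"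
      by (simp add: product_map_eq_iff[OF y])
    moreover have "restrict x {1..v} \<in> PiE {1..v} X" using x by auto
    ultimately show "y \<in> product_map v f ` PiE {1..v} X" by blast
  qed
qed

section \<open>Shy factors give a shy product map\<close>

lemma shy_product_map:
  assumes shy: "\<And>i. i \<in> {1..v} \<Longrightarrow> shy (X i) (\<kappa> i) (Y i) (\<mu> i) (f i)"
    and sym: "\<And>i. i \<in> {1..v} \<Longrightarrow> sym (\<kappa> i)"
  shows "shy (PiE {1..v} X) (NP_adj v X \<kappa>) (PiE {1..v} Y) (NP_adj v Y \<mu>) (product_map v f)"
proof -
  let ?F = "\<lambda>y. product_map v f -` {y} \<inter> PiE {1..v} X"
  have surj: "f i ` X i = Y i" if "i \<in> {1..v}" for i
    using shy[OF that] by (simp add: shy_def)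
  have fibre: "digitally_connected (NP_adj v X \<kappa>) (?F y)" if y: "y \<in> PiE {1..v} Y" for y
    unfolding product_map_vimage[OF y]
  proof (rule digitally_connected_PiE)
    fix i assume i: "i \<in> {1..v}"
    with y have "y i \<in> Y i" by auto
    with shy[OF i] show "digitally_connected (\<kappa> i) (f i -` {y i} \<inter> X i)"
      by (simp add: shy_def)
  qed auto
  have pair: "digitally_connected (NP_adj v X \<kappa>) (product_map v f -` {y, y'} \<inter> PiE {1..v} X)"
    if y: "y \<in> PiE {1..v} Y" and y': "y' \<in> PiE {1..v} Y" and adj: "(y, y') \<in> NP_adj v Y \<mu>" for y y'
  proof -
    have "\<exists>a b. a \<in> X i \<and> b \<in> X i \<and> f i a = y i \<and> f i b = y' i \<and> (a = b \<or> (a, b) \<in> \<kappa> i)"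
      if i: "i \<in> {1..v}" for i
    proof -
      have yi: "y i \<in> Y i" "y' i \<in> Y i" using y y' i by auto
      obtain s t where st: "s \<in> X i" "t \<in> X i" "f i s = y i" "f i t = y' i"
        using yi surj[OF i] by (metis imageE)
      show ?thesis
      proof (cases "y i = y' i")
        case True
        \<comment> \<open>Here \<open>s\<close> serves as both points.\<close>
        with st show ?thesis by auto
      next
        case False
        then have "(y i, y' i) \<in> \<mu> i" using adj i by (auto simp: NP_adj_def)
        with shy[OF i] yi
        have "digitally_connected (\<kappa> i) (f i -` {y i, y' i} \<inter> X i)" by (simp add: shy_def)
        \<comment> \<open>With the fibre over \<open>y i\<close> as the set to be left, the path
          from \<open>s\<close> to \<open>t\<close> must cross; \<open>b\<close> is then over
          \<open>y' i\<close>, the only other value available.\<close>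
        then obtain a b where "a \<in> f i -` {y i, y' i} \<inter> X i" "b \<in> f i -` {y i, y' i} \<inter> X i"
          "a \<in> f i -` {y i}" "b \<notin> f i -` {y i}" "(a, b) \<in> \<kappa> i"
          by (rule digitally_connected_crossing[of _ _ s t "f i -` {y i}"]) (use st False in auto)
        then show ?thesis by auto
      qed
    qed
    then obtain a b where ab: "\<And>i. i \<in> {1..v} \<Longrightarrow> a i \<in> X i \<and> b i \<in> X i \<and>
        f i (a i) = y i \<and> f i (b i) = y' i \<and> (a i = b i \<or> (a i, b i) \<in> \<kappa> i)"
      by metis
    \<comment> \<open>The pointwise choices become tuples only after restriction, which makes them
      extensional.\<close>
    let ?a = "restrict a {1..v}" and ?b = "restrict b {1..v}"
    have "?a \<in> ?F y" "?b \<in> ?F y'"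
      using ab by (auto simp: product_map_eq_iff[OF y] product_map_eq_iff[OF y'])
    moreover have "?a = ?b \<or> (?a, ?b) \<in> NP_adj v X \<kappa>"
      using ab by (auto simp: NP_adj_def)
    ultimately have "digitally_connected (NP_adj v X \<kappa>) (?F y \<union> ?F y')"
      using digitally_connected_Un[OF fibre[OF y] fibre[OF y']] sym_NP_adj[of v \<kappa>] sym by blast
    moreover have "?F y \<union> ?F y' = product_map v f -` {y, y'} \<inter> PiE {1..v} X" by auto
    ultimately show ?thesis by simp
  qed
  have cont: "digitally_continuous (X i) (\<kappa> i) (Y i) (\<mu> i) (f i)" if "i \<in> {1..v}" for i
    using shy[OF that] by (simp add: shy_def)
  have "digitally_continuous (PiE {1..v} X) (NP_adj v X \<kappa>) (PiE {1..v} Y) (NP_adj v Y \<mu>)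
      (product_map v f)"
    using cont by (rule digitally_continuous_product_map)
  moreover have "product_map v f ` PiE {1..v} X = PiE {1..v} Y"
    using surj by (rule product_map_image)
  ultimately show ?thesis using fibre pair unfolding shy_def by blast
qed

section \<open>A shy product map gives shy factors\<close>

text \<open>Projection to coordinate \<open>i\<close> preserves connectedness, and
  \<open>lift\<close> and \<open>proj\<close> make its image exactly the fibre over
  \<open>S\<close>. General \<open>C\<close> and \<open>S\<close> serve both single values and
  adjacent pairs.\<close>

lemma digitally_connected_component_vimage:
  assumes conn: "digitally_connected (NP_adj v X \<kappa>) (product_map v f -` C \<inter> PiE {1..v} X)"
    and i: "i \<in> {1..v}"
    and lift: "\<And>s. s \<in> X i \<Longrightarrow> f i s \<in> S \<Longrightarrow>
      \<exists>x\<in>PiE {1..v} X. x i = s \<and> product_map v f x \<in> C"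
    and proj: "\<And>z. z \<in> C \<Longrightarrow> z i \<in> S"
  shows "digitally_connected (\<kappa> i) (f i -` S \<inter> X i)"
proof -
  have "digitally_connected (\<kappa> i) ((\<lambda>x. x i) ` (product_map v f -` C \<inter> PiE {1..v} X))"
    using conn by (rule digitally_connected_image) (use i in \<open>auto simp: NP_adj_def\<close>)
  moreover have "(\<lambda>x. x i) ` (product_map v f -` C \<inter> PiE {1..v} X) = f i -` S \<inter> X i"
  proof
    show "(\<lambda>x. x i) ` (product_map v f -` C \<inter> PiE {1..v} X) \<subseteq> f i -` S \<inter> X i"
      using i proj product_map_apply[OF i, of f] by fastforce
  next
    show "f i -` S \<inter> X i \<subseteq> (\<lambda>x. x i) ` (product_map v f -` C \<inter> PiE {1..v} X)"
      using lift by fastforce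
  qed
  ultimately show ?thesis by simp
qed

lemma shy_component:
  assumes shy: "shy (PiE {1..v} X) (NP_adj v X \<kappa>) (PiE {1..v} Y) (NP_adj v Y \<mu>) (product_map v f)"
    and i: "i \<in> {1..v}"
    and ne: "\<And>j. j \<in> {1..v} \<Longrightarrow> X j \<noteq> {}"
    and cont: "\<And>j. j \<in> {1..v} \<Longrightarrow> digitally_continuous (X j) (\<kappa> j) (Y j) (\<mu> j) (f j)"
    and surj: "f i ` X i = Y i"
    and irrefl: "irrefl (\<mu> i)"
  shows "shy (X i) (\<kappa> i) (Y i) (\<mu> i) (f i)"
proof -
  \<comment> \<open>The base tuple is chosen in the domain and \<open>q\<close> is its image. A
    point of \<open>X i\<close> then lifts by overwriting coordinate \<open>i\<close> of
    \<open>p\<close>, the other coordinates already lying over those of \<open>q\<close>.\<close>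
  obtain p where p: "p \<in> PiE {1..v} X" using ne by (metis PiE_eq_empty_iff ex_in_conv)
  define q where "q = product_map v f p"
  have q: "q \<in> PiE {1..v} Y"
    using p shy unfolding q_def shy_def by blast
  have qu: "q(i := u) \<in> PiE {1..v} Y" if "u \<in> Y i" for u
    using q i that by (auto simp: PiE_iff extensional_def)
  have lift: "\<exists>x\<in>PiE {1..v} X. x i = s \<and> product_map v f x = q(i := f i s)" if "s \<in> X i" for s
  proof
    show "p(i := s) \<in> PiE {1..v} X" using p i that by (auto simp: PiE_iff extensional_def)
    show "(p(i := s)) i = s \<and> product_map v f (p(i := s)) = q(i := f i s)"
      using i by (auto simp: q_def product_map_def fun_eq_iff)
  qed
  have "digitally_connected (\<kappa> i) (f i -` {u} \<inter> X i)" if u: "u \<in> Y i" for u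
  proof (rule digitally_connected_component_vimage[OF _ i])
    show "digitally_connected (NP_adj v X \<kappa>) (product_map v f -` {q(i := u)} \<inter> PiE {1..v} X)"
      using shy qu[OF u] by (simp add: shy_def)
  qed (use lift in auto)
  moreover have "digitally_connected (\<kappa> i) (f i -` {u, w} \<inter> X i)"
    if uw: "u \<in> Y i" "w \<in> Y i" "(u, w) \<in> \<mu> i" for u w
  proof (rule digitally_connected_component_vimage[OF _ i])
    \<comment> \<open>\<open>NP_adj\<close> demands distinct tuples; irreflexivity of
      \<open>\<mu> i\<close> supplies this.\<close>
    have "u \<noteq> w" using uw irrefl by (auto simp: irrefl_def)
    then have "q(i := u) \<noteq> q(i := w)" by (metis fun_upd_same)
    then have "(q(i := u), q(i := w)) \<in> NP_adj v Y \<mu>"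
      using qu uw by (auto simp: NP_adj_def)
    with shy qu uw show "digitally_connected (NP_adj v X \<kappa>)
        (product_map v f -` {q(i := u), q(i := w)} \<inter> PiE {1..v} X)"
      by (simp add: shy_def)
  qed (use lift in auto)
  ultimately show ?thesis using cont[OF i] surj by (simp add: shy_def)
qed

theorem theorem12p1:
  fixes v :: nat
    and X Y :: "nat \<Rightarrow> int list set"
    and \<kappa> \<mu> :: "nat \<Rightarrow> (int list \<times> int list) set"
    and f :: "nat \<Rightarrow> int list \<Rightarrow> int list"
  assumes "v \<ge> 1"
    and "\<And>i. i \<in> {1..v} \<Longrightarrow> digital_image (X i) (\<kappa> i)"
    and "\<And>i. i \<in> {1..v} \<Longrightarrow> digital_image (Y i) (\<mu> i)"
    and "\<And>i. i \<in> {1..v} \<Longrightarrow> X i \<noteq> {}"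
    and "\<And>i. i \<in> {1..v} \<Longrightarrow> Y i \<noteq> {}"
    and "\<And>i. i \<in> {1..v} \<Longrightarrow> digitally_continuous (X i) (\<kappa> i) (Y i) (\<mu> i) (f i)"
    and "\<And>i. i \<in> {1..v} \<Longrightarrow> f i ` X i = Y i"
  shows "shy (PiE {1..v} X) (NP_adj v X \<kappa>) (PiE {1..v} Y) (NP_adj v Y \<mu>) (product_map v f)
    \<longleftrightarrow> (\<forall>i\<in>{1..v}. shy (X i) (\<kappa> i) (Y i) (\<mu> i) (f i))"
proof
  assume "shy (PiE {1..v} X) (NP_adj v X \<kappa>) (PiE {1..v} Y) (NP_adj v Y \<mu>) (product_map v f)"
  then show "\<forall>i\<in>{1..v}. shy (X i) (\<kappa> i) (Y i) (\<mu> i) (f i)"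
    using shy_component assms(3,4,6,7) by (metis digital_image_def)
next
  assume "\<forall>i\<in>{1..v}. shy (X i) (\<kappa> i) (Y i) (\<mu> i) (f i)"
  then show "shy (PiE {1..v} X) (NP_adj v X \<kappa>) (PiE {1..v} Y) (NP_adj v Y \<mu>) (product_map v f)"
    using assms(2) by (intro shy_product_map) (auto simp: digital_image_def)
qed

end
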